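(* Let $\lambda_2\ge 0$ and let $(\eta^{(t)})_{t\ge 0}$ be a sequence of positive learning rates (possibly varying with $t$) with $\eta^{(t)}\lambda_2<1$ for all $t\ge 0$. Let $0\le\psi_j\le k$ be integers, and suppose that the real weight $w_j$ evolves, for every $t$ with $\psi_j\le t<k$, by the $\ell_2^2$ SGD regularization update $$w_j^{(t+1)}=w_j^{(t)}-\eta^{(t)}\lambda_2 w_j^{(t)} .$$ Let $P(t)=\prod_{\tau=0}^{t}(1-\eta^{(\tau)}\lambda_2)$ for $t\ge 0$, and $P(-1)=1$ (empty product). Then $$w_j^{(k)}=w_j^{(\psi_j)}\,\frac{P(k-1)}{P(\psi_j-1)} .$$ In particular, given stored values of $P$, the $k-\psi_j$ successive updates can be applied with a number of arithmetic operations bounded independently of $k-\psi_j$.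
   Context: Setting: a linear model with weight vector $w\in\mathbb{R}^d$ is trained by stochastic gradient descent (SGD) with squared-norm ($\ell_2^2$) regularization of strength $\lambda_2$. At time steps when the current example has feature value $x_{ij}=0$, the loss does not contribute to the $j$-th coordinate of the gradient and only the regularization update displayed in the claim is applied to $w_j$. The superscript $(t)$ denotes the value at iteration $t$; $\psi_j$ is the last iteration at which the stored value of $w_j$ was current, and $k$ is the current iteration. *)

theory Defs
  imports Complex_Main
begin

text \<open>The index is an integer so that \<open>decay_prod \<eta> lam (-1)\<close> is the empty product \<open>1\<close>.\<close>

definition decay_prod :: "(nat \<Rightarrow> real) \<Rightarrow> real \<Rightarrow> int \<Rightarrow> real" where
  "decay_prod \<eta> lam t = (\<Prod>\<tau>=0..t. 1 - \<eta> (nat \<tau>) * lam)"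

text \<open>The single coordinate \<open>w\<close> is constrained only on the time window from \<open>\<psi>\<close> to \<open>k\<close>.\<close>

definition l2_sgd_run ::
    "real \<Rightarrow> (nat \<Rightarrow> real) \<Rightarrow> nat \<Rightarrow> nat \<Rightarrow> (nat \<Rightarrow> real) \<Rightarrow> bool" where
  "l2_sgd_run lam \<eta> \<psi> k w \<longleftrightarrow>
     0 \<le> lam \<and> (\<forall>t. 0 < \<eta> t) \<and> (\<forall>t. \<eta> t * lam < 1) \<and> \<psi> \<le> k \<and>
     (\<forall>t. \<psi> \<le> t \<and> t < k \<longrightarrow> w (t + 1) = w t - \<eta> t * lam * w t)"

text \<open>
  To count arithmetic operations we use a register machine over the integers (for time indices)
  and the reals, with read-only tables and counted loops.  Programs contain only integer literals,
  so all other data must come from the input.  Stepping through the updates one by one is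
  expressible with \<open>Repeat\<close>, at a cost that grows linearly in the number of updates.
\<close>

datatype table = Eta_Table | Prod_Table

datatype iexp =
    IConst int
  | IReg nat
  | IAdd iexp iexp
  | ISub iexp iexp

datatype rexp =
    RConst int
  | RReg nat
  | Lookup table iexp
  | RAdd rexp rexp
  | RSub rexp rexp
  | RMul rexp rexp
  | RDiv rexp rexp

datatype prog =
    ISet nat iexp
  | RSet nat rexp
  | Seq prog prog
  | Repeat iexp prog

type_synonym state = "(nat \<Rightarrow> int) \<times> (nat \<Rightarrow> real)"
type_synonym memory = "table \<Rightarrow> int \<Rightarrow> real option"

primrec ival :: "iexp \<Rightarrow> (nat \<Rightarrow> int) \<Rightarrow> int" where
  "ival (IConst c) is = c"
| "ival (IReg r) is = is r"
| "ival (IAdd a b) is = ival a is + ival b is"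
| "ival (ISub a b) is = ival a is - ival b is"

primrec icost :: "iexp \<Rightarrow> nat" where
  "icost (IConst c) = 0"
| "icost (IReg r) = 0"
| "icost (IAdd a b) = icost a + icost b + 1"
| "icost (ISub a b) = icost a + icost b + 1"

text \<open>Division by zero and reading an entry that is not stored are run-time errors (\<open>None\<close>).\<close>

definition lift2 :: "(real \<Rightarrow> real \<Rightarrow> real) \<Rightarrow> real option \<Rightarrow> real option \<Rightarrow> real option" where
  "lift2 f x y = Option.bind x (\<lambda>a. map_option (f a) y)"

primrec rval :: "memory \<Rightarrow> rexp \<Rightarrow> state \<Rightarrow> real option" where
  "rval m (RConst c) s = Some (of_int c)"
| "rval m (RReg r) s = Some (snd s r)"
| "rval m (Lookup T i) s = m T (ival i (fst s))"
| "rval m (RAdd a b) s = lift2 (+) (rval m a s) (rval m b s)"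
| "rval m (RSub a b) s = lift2 (-) (rval m a s) (rval m b s)"
| "rval m (RMul a b) s = lift2 (*) (rval m a s) (rval m b s)"
| "rval m (RDiv a b) s =
     (if rval m b s = Some 0 then None else lift2 (/) (rval m a s) (rval m b s))"

text \<open>Table lookups are charged one unit as well.\<close>

primrec rcost :: "rexp \<Rightarrow> nat" where
  "rcost (RConst c) = 0"
| "rcost (RReg r) = 0"
| "rcost (Lookup T i) = icost i + 1"
| "rcost (RAdd a b) = rcost a + rcost b + 1"
| "rcost (RSub a b) = rcost a + rcost b + 1"
| "rcost (RMul a b) = rcost a + rcost b + 1"
| "rcost (RDiv a b) = rcost a + rcost b + 1"

text \<open>
  A successful execution returns the final state and the number of operations performed;
  every loop iteration costs one extra unit for the loop counter.
\<close>

primrec exec :: "memory \<Rightarrow> prog \<Rightarrow> state \<Rightarrow> (state \<times> nat) option" where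
  "exec m (ISet r e) s = Some (((fst s)(r := ival e (fst s)), snd s), icost e)"
| "exec m (RSet r e) s =
     map_option (\<lambda>v. ((fst s, (snd s)(r := v)), rcost e)) (rval m e s)"
| "exec m (Seq p q) s =
     Option.bind (exec m p s) (\<lambda>(s', c).
       map_option (\<lambda>(s'', d). (s'', c + d)) (exec m q s'))"
| "exec m (Repeat e p) s =
     ((\<lambda>res. Option.bind res (\<lambda>(s', c).
         map_option (\<lambda>(s'', d). (s'', c + d + 1)) (exec m p s')))
       ^^ nat (ival e (fst s))) (Some (s, icost e))"

text \<open>
  Input convention: integer registers 0 and 1 hold \<open>\<psi>\<close> and \<open>k\<close>, real registers 0 and 1 hold the
  stale weight and \<open>lam\<close>.  At iteration \<open>k\<close> the tables hold \<open>\<eta>\<close> at \<open>0, \<dots>, k - 1\<close> and the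
  products at \<open>-1, \<dots>, k - 1\<close>.
\<close>

definition init_state :: "real \<Rightarrow> nat \<Rightarrow> nat \<Rightarrow> real \<Rightarrow> state" where
  "init_state lam \<psi> k v =
     ((\<lambda>_. 0)(0 := int \<psi>, 1 := int k), (\<lambda>_. 0)(0 := v, 1 := lam))"

definition stored :: "real \<Rightarrow> (nat \<Rightarrow> real) \<Rightarrow> nat \<Rightarrow> memory" where
  "stored lam \<eta> k T t = (case T of
       Eta_Table \<Rightarrow> if 0 \<le> t \<and> t < int k then Some (\<eta> (nat t)) else None
     | Prod_Table \<Rightarrow> if -1 \<le> t \<and> t < int k then Some (decay_prod \<eta> lam t) else None)"

end

theory Submission
  imports Defs
begin

text \<open>Each update multiplies the weight by \<open>1 - \<eta> t * lam\<close>, which is also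
  the factor by which the running product grows at time \<open>t\<close>. Hence the weight stays
  proportional to the running product over the window (\<open>l2_sgd_run_invariant\<close>). Since
  every factor is positive, one may divide by the product before \<psi>. The resulting quotient
  needs just two stored products, so the loop-free program \<open>catch_up\<close> evaluates it at a
  fixed cost.\<close>

lemma decay_prod_step:
  "decay_prod \<eta> lam (int (Suc n) - 1) = decay_prod \<eta> lam (int n - 1) * (1 - \<eta> n * lam)"
proof -
  \<comment> \<open>For \<open>n = 0\<close> the remaining interval ends at -1 and is empty, so the
    convention for the product at -1 is covered.\<close>
  have "{0..int n} = insert (int n) {0..int n - 1}"
    by auto
  then show ?thesis
    by (simp add: decay_prod_def)
qed

lemma decay_prod_pos:
  assumes "\<And>t. \<eta> t * lam < 1"
  shows "0 < decay_prod \<eta> lam t"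
  unfolding decay_prod_def using assms by (intro prod_pos) simp

lemma l2_sgd_run_decay_prod_pos:
  "l2_sgd_run lam \<eta> \<psi> k w \<Longrightarrow> 0 < decay_prod \<eta> lam t"
  by (rule decay_prod_pos) (simp add: l2_sgd_run_def)

text \<open>The cross-multiplied form keeps the induction free of division; positivity enters only
  when the closed form is derived.\<close>

lemma l2_sgd_run_invariant:
  assumes run: "l2_sgd_run lam \<eta> \<psi> k w"
  shows "w k * decay_prod \<eta> lam (int \<psi> - 1) = w \<psi> * decay_prod \<eta> lam (int k - 1)"
proof -
  have "\<psi> \<le> k" and update: "\<And>t. \<psi> \<le> t \<Longrightarrow> t < k \<Longrightarrow> w (Suc t) = w t * (1 - \<eta> t * lam)"
    using run by (auto simp: l2_sgd_run_def algebra_simps)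
  \<comment> \<open>The bound by \<open>k\<close> stays inside the induction claim because the
    update law holds only within the window.\<close>
  have "n \<le> k \<longrightarrow>
      w n * decay_prod \<eta> lam (int \<psi> - 1) = w \<psi> * decay_prod \<eta> lam (int n - 1)"
    if "\<psi> \<le> n" for n
    using that
  proof (induction n rule: dec_induct)
    case base
    show ?case by simp
  next
    case (step n)
    show ?case
    proof
      assume "Suc n \<le> k"
      then have "w (Suc n) * decay_prod \<eta> lam (int \<psi> - 1)
          = (w n * decay_prod \<eta> lam (int \<psi> - 1)) * (1 - \<eta> n * lam)"
        using update[of n] step.hyps by simp
      also have "\<dots> = w \<psi> * decay_prod \<eta> lam (int n - 1) * (1 - \<eta> n * lam)"
        using step.IH \<open>Suc n \<le> k\<close> by simp
      also have "\<dots> = w \<psi> * decay_prod \<eta> lam (int (Suc n) - 1)"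
        unfolding decay_prod_step by (simp only: mult.assoc)
      finally show "w (Suc n) * decay_prod \<eta> lam (int \<psi> - 1)
          = w \<psi> * decay_prod \<eta> lam (int (Suc n) - 1)" .
    qed
  qed
  then show ?thesis
    using \<open>\<psi> \<le> k\<close> by blast
qed

lemma l2_sgd_run_closed_form:
  assumes "l2_sgd_run lam \<eta> \<psi> k w"
  shows "w k = w \<psi> * (decay_prod \<eta> lam (int k - 1) / decay_prod \<eta> lam (int \<psi> - 1))"
  using l2_sgd_run_invariant[OF assms]
    l2_sgd_run_decay_prod_pos[OF assms, of "int \<psi> - 1"]
  by (simp add: field_simps)

definition catch_up :: prog where
  "catch_up = RSet 0 (RMul (RReg 0)
     (RDiv (Lookup Prod_Table (ISub (IReg 1) (IConst 1)))
           (Lookup Prod_Table (ISub (IReg 0) (IConst 1)))))"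

text \<open>The cost 6 comes from two index subtractions, two lookups, one division and one
  multiplication. Since \<psi> \<le> k, both indices lie between -1 and \<open>k - 1\<close>, so
  both entries are stored; the divisor is positive, so no run-time error occurs.\<close>

lemma exec_catch_up:
  assumes run: "l2_sgd_run lam \<eta> \<psi> k w"
  shows "\<exists>s. exec (stored lam \<eta> k) catch_up (init_state lam \<psi> k (w \<psi>)) = Some (s, 6)
      \<and> snd s 0 = w k"
proof -
  have "\<psi> \<le> k"
    using run by (simp add: l2_sgd_run_def)
  moreover have "decay_prod \<eta> lam (int \<psi> - 1) \<noteq> 0"
    using l2_sgd_run_decay_prod_pos[OF run, of "int \<psi> - 1"] by simp
  ultimately show ?thesis
    by (simp add: catch_up_def stored_def init_state_def lift2_def l2_sgd_run_closed_form[OF run])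
qed

theorem lemma1:
  "(\<forall>(lam::real) (\<eta>::nat \<Rightarrow> real) (\<psi>::nat) (k::nat) (w::nat \<Rightarrow> real).
      l2_sgd_run lam \<eta> \<psi> k w \<longrightarrow>
      w k = w \<psi> * (decay_prod \<eta> lam (int k - 1) / decay_prod \<eta> lam (int \<psi> - 1))) \<and>
   (\<exists>(p::prog) (C::nat).
      \<forall>(lam::real) (\<eta>::nat \<Rightarrow> real) (\<psi>::nat) (k::nat) (w::nat \<Rightarrow> real).
        l2_sgd_run lam \<eta> \<psi> k w \<longrightarrow>
        (\<exists>s c. exec (stored lam \<eta> k) p (init_state lam \<psi> k (w \<psi>)) = Some (s, c) \<and>
               snd s 0 = w k \<and> c \<le> C))"
  \<comment> \<open>The witnesses are \<open>catch_up\<close> and 6, neither of which depends on the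
    run.\<close>
  using l2_sgd_run_closed_form exec_catch_up by (metis order_refl)

end
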